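(* For $n\ge 3$ let $K_n$ denote the useful orientation of the complete graph on $n$ vertices, and let $c=\frac{n(n-3)}{2}+1$. Then $T_c(K_n)=\Omega((n-1)!)$ as $n\to\infty$; that is, there exist a constant $\kappa>0$ and an integer $N$ such that for all $n\ge N$, with $c=\frac{n(n-3)}{2}+1$, one has $T_c(K_n)\ge \kappa\,(n-1)!$.
   Context: A directed graph $D=(V,E)$ is a finite set of vertices $V$ with a set $E$ of ordered pairs of vertices; $(u,v)\in E$ is an edge directed from $u$ to $v$, and the out-degree $\deg^+ v$ is the number of edges directed from $v$. A parallel chip-firing game on $D$ starts with a finite nonnegative integer number of chips on each vertex. In each round, simultaneously, every vertex $v$ having at least $\deg^+ v$ chips fires, sending one chip along each of its outgoing edges; all other vertices wait. The game has period $T$ if $T$ is the smallest positive integer for which there is a round $t_0$ such that every vertex has the same number of chips in round $t$ as in round $t+T$ for all $t\ge t_0$. For a nonnegative integer $c$, the $c$-convergent period $T_c(D)$ is the minimum of the period $T$ over all parallel chip-firing games on $D$ with at least $c$ chips in total. The useful orientation of the complete graph on vertices $v_1,\dots,v_n$ has exactly the following edges: (i) from $v_i$ to $v_{i+1}$ for each $1\le i<n$, and from $v_n$ to $v_1$; (ii) from $v_1$ to every other vertex except $v_n$; (iii) from $v_j$ to all vertices $v_k$ with $1<k\le j-2$. *)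

theory Defs
  imports
    Complex_Main
    "HOL-Library.Landau_Symbols"
    "Graph_Theory.Pair_Digraph"
begin

text \<open>
  A chip configuration on \<open>D\<close> is a function from vertices to natural numbers. Only its values
  on \<open>pverts D\<close> matter; totals and periods below never look at other arguments.
\<close>

definition fires :: "'a pair_pre_digraph \<Rightarrow> ('a \<Rightarrow> nat) \<Rightarrow> 'a \<Rightarrow> bool" where
  "fires D s v \<longleftrightarrow> out_degree D v \<le> s v"

definition chip_round :: "'a pair_pre_digraph \<Rightarrow> ('a \<Rightarrow> nat) \<Rightarrow> 'a \<Rightarrow> nat" where
  "chip_round D s v =
     s v - (if fires D s v then out_degree D v else 0) +
     card {u \<in> pverts D. (u, v) \<in> parcs D \<and> fires D s u}"

definition chips_at :: "'a pair_pre_digraph \<Rightarrow> ('a \<Rightarrow> nat) \<Rightarrow> nat \<Rightarrow> 'a \<Rightarrow> nat" where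
  "chips_at D s t = (chip_round D ^^ t) s"

definition total_chips :: "'a pair_pre_digraph \<Rightarrow> ('a \<Rightarrow> nat) \<Rightarrow> nat" where
  "total_chips D s = (\<Sum>v\<in>pverts D. s v)"

definition game_period :: "'a pair_pre_digraph \<Rightarrow> ('a \<Rightarrow> nat) \<Rightarrow> nat" where
  "game_period D s =
     (LEAST T. T > 0 \<and>
        (\<exists>t0. \<forall>t\<ge>t0. \<forall>v\<in>pverts D. chips_at D s t v = chips_at D s (t + T) v))"

definition convergent_period :: "nat \<Rightarrow> 'a pair_pre_digraph \<Rightarrow> nat" where
  "convergent_period c D = (LEAST T. \<exists>s. total_chips D s \<ge> c \<and> game_period D s = T)"

text \<open>
  The vertex \<open>v\<^sub>i\<close> is the number \<open>i\<close>. The condition \<open>k + 2 \<le> j\<close> stands for \<open>k \<le> j - 2\<close>, which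
  would involve truncated subtraction. The definition is meant for \<open>n \<ge> 3\<close>.
\<close>

definition useful_orientation :: "nat \<Rightarrow> nat pair_pre_digraph" where
  "useful_orientation n =
     \<lparr> pverts = {1..n},
       parcs = {(i, i + 1) | i. 1 \<le> i \<and> i < n} \<union> {(n, 1)} \<union>
               {(1, k) | k. 1 < k \<and> k < n} \<union>
               {(j, k) | j k. j \<le> n \<and> 1 < k \<and> k + 2 \<le> j} \<rparr>"

lemma useful_orientation_arc_iff:
  "(u, v) \<in> parcs (useful_orientation n) \<longleftrightarrow>
     (1 \<le> u \<and> u < n \<and> v = u + 1) \<or> (u = n \<and> v = 1) \<or>
     (u = 1 \<and> 1 < v \<and> v < n) \<or> (u \<le> n \<and> 1 < v \<and> v + 2 \<le> u)"
  unfolding useful_orientation_def pair_pre_digraph.simps Un_iff mem_Collect_eq by blast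

lemma pair_digraph_useful_orientation:
  assumes "n \<ge> 3"
  shows "pair_digraph (useful_orientation n)"
proof -
  have V: "pverts (useful_orientation n) = {1..n}"
    by (simp add: useful_orientation_def)
  have arc: "u \<in> {1..n} \<and> v \<in> {1..n} \<and> u \<noteq> v"
    if "(u, v) \<in> parcs (useful_orientation n)" for u v
    using that assms unfolding useful_orientation_arc_iff atLeastAtMost_iff by linarith
  then have sub: "parcs (useful_orientation n) \<subseteq> {1..n} \<times> {1..n}"
    by (intro subrelI) blast
  have fin: "finite (parcs (useful_orientation n))"
    by (rule finite_subset[OF sub]) simp
  show ?thesis
  proof
    fix e assume "e \<in> parcs (useful_orientation n)"
    then show "fst e \<in> pverts (useful_orientation n)" "snd e \<in> pverts (useful_orientation n)"
      "fst e \<noteq> snd e"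
      using arc[of "fst e" "snd e"] by (auto simp only: V prod.collapse)
  qed (simp_all add: V fin)
qed

lemma useful_orientation_orients_complete_graph:
  assumes "n \<ge> 3" "u \<in> {1..n}" "v \<in> {1..n}" "u \<noteq> v"
  shows "(u, v) \<in> parcs (useful_orientation n) \<longleftrightarrow> (v, u) \<notin> parcs (useful_orientation n)"
  using assms unfolding useful_orientation_arc_iff atLeastAtMost_iff by presburger

end

theory Submission
  imports Defs
begin

text \<open>
  Over one period every vertex returns to its chip count, so the firing counts \<open>x\<close> satisfy
  \<open>deg\<^sup>+ v \<cdot> x v = \<Sum> x u\<close>, summed over the in-neighbours \<open>u\<close> of \<open>v\<close>. For the useful orientation this
  system determines \<open>x\<close> from \<open>x 1\<close>, going down from \<open>n\<close>: every \<open>x k\<close> is a multiple of \<open>x 1\<close>, with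
  \<open>x (k - 1)\<close> roughly \<open>(k - 2) x k\<close>, so that \<open>x 4\<close> is of order \<open>(n - 1)! x 1\<close>. A configuration in
  which nobody fires has at most \<open>\<Sum> (deg\<^sup>+ v - 1) = n (n - 3) / 2\<close> chips; with one chip more some
  vertex fires in every round, which forces \<open>x 1 > 0\<close>. A vertex fires at most once per round, so
  the period is at least \<open>x 4\<close>.
\<close>

section \<open>Parallel chip-firing on a finite digraph\<close>

context pair_fin_digraph
begin

lemma out_degree_eq_card: "out_degree G u = card {v \<in> pverts G. (u, v) \<in> parcs G}"
proof -
  have "out_arcs G u = Pair u ` {v \<in> pverts G. (u, v) \<in> parcs G}"
    using in_arcsD2 by (auto simp: out_arcs_def)
  then show ?thesis
    by (simp add: out_degree_def card_image inj_on_def)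
qed

text \<open>Fired chips are added on the left instead of subtracted on the right; without truncated
  subtraction the identity can be summed over vertices and over rounds.\<close>

lemma chip_round_balance:
  "chip_round G s v + out_degree G v * of_bool (fires G s v) =
     s v + (\<Sum>u | u \<in> pverts G \<and> (u, v) \<in> parcs G. of_bool (fires G s u))"
proof -
  have "card {u \<in> pverts G. (u, v) \<in> parcs G \<and> fires G s u} =
      (\<Sum>u | u \<in> pverts G \<and> (u, v) \<in> parcs G. of_bool (fires G s u))"
    by (simp add: of_bool_def sum.If_cases Int_def conj_assoc)
  then show ?thesis
    by (auto simp: chip_round_def fires_def)
qed

text \<open>The arcs leaving firing vertices are counted once by head (chips received) and once by
  tail (chips sent).\<close>

lemma total_chips_chip_round: "total_chips G (chip_round G s) = total_chips G s"
proof -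
  let ?f = "\<lambda>u. of_bool (fires G s u) :: nat"
  have "(\<Sum>v\<in>pverts G. \<Sum>u | u \<in> pverts G \<and> (u, v) \<in> parcs G. ?f u) =
      (\<Sum>u\<in>pverts G. \<Sum>v | v \<in> pverts G \<and> (u, v) \<in> parcs G. ?f u)"
    by (rule sum.swap_restrict) simp_all
  also have "\<dots> = (\<Sum>u\<in>pverts G. out_degree G u * ?f u)"
    by (simp add: out_degree_eq_card)
  finally have "(\<Sum>v\<in>pverts G. \<Sum>u | u \<in> pverts G \<and> (u, v) \<in> parcs G. ?f u) =
      (\<Sum>u\<in>pverts G. out_degree G u * ?f u)" .
  moreover have "(\<Sum>v\<in>pverts G. chip_round G s v + out_degree G v * ?f v) =
      (\<Sum>v\<in>pverts G. s v + (\<Sum>u | u \<in> pverts G \<and> (u, v) \<in> parcs G. ?f u))"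
    by (simp only: chip_round_balance)
  ultimately show ?thesis
    by (simp only: total_chips_def sum.distrib)
qed

lemma chips_at_Suc: "chips_at G s (Suc t) = chip_round G (chips_at G s t)"
  by (simp add: chips_at_def)

lemma total_chips_chips_at: "total_chips G (chips_at G s t) = total_chips G s"
  by (induction t) (simp_all add: chips_at_Suc total_chips_chip_round, simp add: chips_at_def)

section \<open>Eventual periodicity\<close>

lemma chip_round_cong:
  assumes "\<And>v. v \<in> pverts G \<Longrightarrow> s v = s' v" "v \<in> pverts G"
  shows "chip_round G s v = chip_round G s' v"
proof -
  have "{u \<in> pverts G. (u, v) \<in> parcs G \<and> fires G s u} =
      {u \<in> pverts G. (u, v) \<in> parcs G \<and> fires G s' u}"
    using assms(1) by (auto simp: fires_def)
  then show ?thesis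
    using assms by (simp add: chip_round_def fires_def)
qed

text \<open>Pigeonhole: the conserved total bounds every vertex, so only finitely many
  configurations occur on \<open>pverts G\<close>. Once one recurs, determinism repeats everything
  after it. Hence the \<open>LEAST\<close> in \<open>game_period\<close> is attained.\<close>

lemma eventually_periodic:
  "\<exists>T>0. \<exists>t0. \<forall>t\<ge>t0. \<forall>v\<in>pverts G. chips_at G s t v = chips_at G s (t + T) v"
proof -
  let ?r = "\<lambda>t. restrict (chips_at G s t) (pverts G)"
  have "chips_at G s t v \<le> total_chips G s" if "v \<in> pverts G" for t v
    using member_le_sum[OF that, of "chips_at G s t"] total_chips_chips_at[of s t]
    by (simp add: total_chips_def)
  then have "range ?r \<subseteq> pverts G \<rightarrow>\<^sub>E {..total_chips G s}"
    by auto
  then have "finite (range ?r)"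
    by (rule finite_subset) (simp add: finite_PiE)
  then have "\<not> inj ?r"
    using finite_imageD by blast
  then obtain i j where "i < j" and eq: "?r i = ?r j"
    using linorder_injI[of ?r] by blast
  have *: "chips_at G s (i + d) v = chips_at G s (j + d) v" if "v \<in> pverts G" for d v
    using that
  proof (induction d arbitrary: v)
    case 0
    then show ?case
      using fun_cong[OF eq, of v] by simp
  next
    case (Suc d)
    then show ?case
      by (simp add: chips_at_Suc) (rule chip_round_cong)
  qed
  have "chips_at G s t v = chips_at G s (t + (j - i)) v" if "i \<le> t" "v \<in> pverts G" for t v
  proof -
    have "i + (t - i) = t" "j + (t - i) = t + (j - i)"
      using \<open>i < j\<close> \<open>i \<le> t\<close> by simp_all
    with * show ?thesis
      using \<open>v \<in> pverts G\<close> by metis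
  qed
  then show ?thesis
    using \<open>i < j\<close> by (meson zero_less_diff)
qed

lemma game_period_periodic:
  shows "game_period G s > 0"
    and "\<exists>t0. \<forall>v\<in>pverts G. chips_at G s (t0 + game_period G s) v = chips_at G s t0 v"
proof -
  have *: "game_period G s > 0 \<and> (\<exists>t0. \<forall>t\<ge>t0. \<forall>v\<in>pverts G.
      chips_at G s t v = chips_at G s (t + game_period G s) v)"
    unfolding game_period_def by (rule LeastI_ex[OF eventually_periodic])
  then show "game_period G s > 0"
    by simp
  from * show "\<exists>t0. \<forall>v\<in>pverts G. chips_at G s (t0 + game_period G s) v = chips_at G s t0 v"
    by (metis order_refl)
qed

section \<open>Firing counts over one period\<close>

lemma chips_at_add_balance:
  "chips_at G s (t + T) v + out_degree G v * (\<Sum>i<T. of_bool (fires G (chips_at G s (t + i)) v)) =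
     chips_at G s t v +
     (\<Sum>u | u \<in> pverts G \<and> (u, v) \<in> parcs G. \<Sum>i<T. of_bool (fires G (chips_at G s (t + i)) u))"
proof (induction T)
  case (Suc T)
  then show ?case
    using chip_round_balance[of "chips_at G s (t + T)" v]
    by (simp add: chips_at_Suc sum.distrib algebra_simps)
qed simp

text \<open>The witness counts the firings of each vertex during one period.\<close>

lemma firing_counts:
  assumes "sum (out_degree G) (pverts G) < total_chips G s + card (pverts G)"
  obtains x :: "'a \<Rightarrow> nat"
  where "\<And>v. x v \<le> game_period G s"
    and "\<And>v. v \<in> pverts G \<Longrightarrow>
           out_degree G v * x v = (\<Sum>u | u \<in> pverts G \<and> (u, v) \<in> parcs G. x u)"
    and "\<exists>v\<in>pverts G. x v > 0"
proof -
  obtain t0 where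
    per: "\<And>v. v \<in> pverts G \<Longrightarrow> chips_at G s (t0 + game_period G s) v = chips_at G s t0 v"
    using game_period_periodic(2) by blast
  define x :: "'a \<Rightarrow> nat" where "x v = (\<Sum>i<game_period G s. of_bool (fires G (chips_at G s (t0 + i)) v))" for v
  show thesis
  proof
    show "x v \<le> game_period G s" for v
      using sum_bounded_above[of "{..<game_period G s}"
          "\<lambda>i. of_bool (fires G (chips_at G s (t0 + i)) v)" "1::nat"]
      by (simp add: x_def)
  next
    fix v assume "v \<in> pverts G"
    then show "out_degree G v * x v = (\<Sum>u | u \<in> pverts G \<and> (u, v) \<in> parcs G. x u)"
      using chips_at_add_balance[of s t0 "game_period G s" v] per by (simp add: x_def)
  next
    \<comment> \<open>If nobody fired, every vertex would hold fewer chips than its out-degree, so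
      the total plus one per vertex would be at most the sum of the out-degrees.\<close>
    have "\<exists>v\<in>pverts G. fires G (chips_at G s t0) v"
    proof (rule ccontr)
      assume "\<not> ?thesis"
      then have "(\<Sum>v\<in>pverts G. chips_at G s t0 v + 1) \<le> sum (out_degree G) (pverts G)"
        by (intro sum_mono) (auto simp: fires_def)
      then show False
        using assms total_chips_chips_at[of s t0] by (simp add: total_chips_def sum_Suc)
    qed
    then obtain v where "v \<in> pverts G" "fires G (chips_at G s t0) v"
      by blast
    then have "x v > 0"
      unfolding x_def by (intro sum_pos2[of _ 0]) (simp_all add: game_period_periodic(1))
    then show "\<exists>v\<in>pverts G. x v > 0"
      using \<open>v \<in> pverts G\<close> by blast
  qed
qed

end

section \<open>The useful orientation\<close>

lemma pverts_useful_orientation: "pverts (useful_orientation n) = {1..n}"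
  by (simp add: useful_orientation_def)

lemma in_neighbours_useful_orientation:
  assumes "n \<ge> 4"
  shows "{u \<in> {1..n}. (u, 1) \<in> parcs (useful_orientation n)} = {n}"
    and "{u \<in> {1..n}. (u, n) \<in> parcs (useful_orientation n)} = {n - 1}"
    and "2 < k \<Longrightarrow> k < n \<Longrightarrow>
      {u \<in> {1..n}. (u, k) \<in> parcs (useful_orientation n)} = insert 1 (insert (k - 1) {k + 2..n})"
  using assms
  by (intro set_eqI; simp only: useful_orientation_arc_iff mem_Collect_eq atLeastAtMost_iff
      insert_iff empty_iff; presburger)+

text \<open>A vertex \<open>j > 2\<close> reaches its cyclic successor and the \<open>j - 3\<close>
  vertices from 2 to \<open>j - 2\<close>. Vertex 2 reaches only its successor, so
  \<open>j - 2\<close> would be wrong there.\<close>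

lemma out_degree_useful_orientation:
  assumes "n \<ge> 4"
  shows "out_degree (useful_orientation n) 1 = n - 2"
    and "out_degree (useful_orientation n) 2 = 1"
    and "2 < j \<Longrightarrow> j \<le> n \<Longrightarrow> out_degree (useful_orientation n) j = j - 2"
proof -
  interpret pair_digraph "useful_orientation n"
    using assms by (intro pair_digraph_useful_orientation) simp
  have "{v \<in> {1..n}. (1, v) \<in> parcs (useful_orientation n)} = {2..<n}"
    "{v \<in> {1..n}. (2, v) \<in> parcs (useful_orientation n)} = {3}"
    using assms unfolding useful_orientation_arc_iff by auto
  then show "out_degree (useful_orientation n) 1 = n - 2"
    "out_degree (useful_orientation n) 2 = 1"
    by (simp_all add: out_degree_eq_card pverts_useful_orientation)
  assume "2 < j" "j \<le> n"
  then have "{v \<in> {1..n}. (j, v) \<in> parcs (useful_orientation n)} =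
      insert (if j = n then 1 else j + 1) {2..<j - 1}"
    using assms unfolding useful_orientation_arc_iff by auto
  then have "out_degree (useful_orientation n) j =
      card (insert (if j = n then 1 else j + 1) {2..<j - 1})"
    by (simp only: out_degree_eq_card pverts_useful_orientation)
  also have "\<dots> = Suc (card {2..<j - 1})"
    by (rule card_insert_disjoint) auto
  also have "\<dots> = j - 2"
    using \<open>2 < j\<close> by simp
  finally show "out_degree (useful_orientation n) j = j - 2" .
qed

text \<open>The value is the number of edges of the complete graph, written so that removing one
  chip per vertex leaves the largest total with nobody firing.\<close>

lemma sum_out_degree_useful_orientation:
  assumes "n \<ge> 4"
  shows "sum (out_degree (useful_orientation n)) {1..n} = n * (n - 3) div 2 + n"
proof -
  have split: "{1..n} = insert 1 (insert 2 {3..n})"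
    using assms by auto
  have "2 * (\<Sum>j = 3..m + 2. j - 2) = m * (m + 1)" for m :: nat
    by (induction m) (simp_all add: algebra_simps)
  from this[of "n - 2"] have "2 * (\<Sum>j = 3..n. j - 2) = (n - 2) * (n - 1)"
    using assms by (simp add: Suc_diff_Suc numeral_2_eq_2 numeral_3_eq_3)
  moreover have "(\<Sum>j = 3..n. out_degree (useful_orientation n) j) = (\<Sum>j = 3..n. j - 2)"
    using assms by (intro sum.cong) (simp_all add: out_degree_useful_orientation(3))
  moreover have "sum (out_degree (useful_orientation n)) {1..n} =
      (n - 2) + 1 + (\<Sum>j = 3..n. out_degree (useful_orientation n) j)"
    unfolding split using assms
    by (subst sum.insert, simp, simp)+
      (simp only: out_degree_useful_orientation(1,2)[OF assms] add.assoc)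
  ultimately have "2 * sum (out_degree (useful_orientation n)) {1..n} =
      (n - 2) * (n - 1) + 2 * (n - 1)"
    using assms by (simp only: distrib_left)
  also have "\<dots> = n * (n - 3) + 2 * n"
  proof -
    obtain j where "n = j + 4"
      using assms that[of "n - 4"] by simp
    then show ?thesis
      by (simp add: algebra_simps)
  qed
  finally show ?thesis
    by simp
qed

section \<open>Growth of the solutions of the balance equations\<close>

lemma harmonic_lower_bound:
  fixes x :: "nat \<Rightarrow> real"
  assumes n: "n \<ge> 6" and pos: "x 1 > 0"
    and xn: "x n = (real n - 2) * x 1" and xn1: "x (n - 1) = (real n - 2) * x n"
    and rec: "\<And>k. 4 \<le> k \<Longrightarrow> Suc k < n \<Longrightarrow> (real k - 1) * x (Suc k) = x 1 + x k + sum x {k + 3..n}"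
  shows "x 4 \<ge> fact (n - 1) / 6 * x 1"
proof -
  note One_nat_def [simp del]
  \<comment> \<open>Since \<open>x k \<ge> (m - 1 / m) x (k + 1)\<close> for \<open>m = k - 1\<close>, and \<open>m - 1 / m = (m - 1) (m + 1) / m\<close>
    telescopes, the right-hand side of the last conjunct does not decrease as \<open>k\<close> falls.\<close>
  let ?P = "\<lambda>k. x 1 + sum x {k + 1..n} \<le> x k
      \<and> (real k - 2) * (x 1 + sum x {k + 2..n}) \<le> x k
      \<and> (real n - 2) * fact (n - 2) * x 1 \<le> (real k - 1) * fact (k - 3) * x k"
  have nonneg: "0 \<le> x 1"
    using pos by simp
  have "?P 4"
  proof (rule inc_induct[of 4 "n - 1"])
    show "4 \<le> n - 1"
      using n by simp
    have xn1': "x (n - 1) = (real n - 2)\<^sup>2 * x 1"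
      by (simp add: xn1 xn power2_eq_square)
    \<comment> \<open>These give the first two conjuncts at \<open>n - 1\<close>, where the first
      sum is just \<open>x n\<close> and the second is empty.\<close>
    have "real n - 1 \<le> (real n - 2)\<^sup>2" "real n - 3 \<le> (real n - 2)\<^sup>2"
      using n mult_mono[of 4 "real n - 2" "real n - 2" "real n - 2"]
      by (simp_all add: power2_eq_square)
    then have "(real n - 1) * x 1 \<le> x (n - 1)" "(real n - 3) * x 1 \<le> x (n - 1)"
      unfolding xn1' using nonneg by (simp_all only: mult_right_mono)
    moreover have "(real n - 2) * fact (n - 2) * x 1 \<le> (real n - 2) * fact (n - 4) * x (n - 1)"
    proof -
      obtain j where j: "n = j + 4"
        using n that[of "n - 4"] by simp
      have "fact (n - 2) \<le> fact (n - 4) * (real n - 2)\<^sup>2"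
        by (simp add: j fact_numeral numeral_2_eq_2 algebra_simps)
      then have "fact (n - 2) * ((real n - 2) * x 1) \<le> fact (n - 4) * (real n - 2)\<^sup>2 * ((real n - 2) * x 1)"
        using n nonneg by (intro mult_right_mono) simp_all
      then show ?thesis
        by (simp add: xn1' mult_ac)
    qed
    ultimately show "?P (n - 1)"
      using n by (simp add: xn of_nat_diff algebra_simps)
  next
    fix k assume k: "4 \<le> k" "k < n - 1" and IH: "?P (Suc k)"
    define y where "y = x (Suc k)"
    have split: "sum x {k + 1..n} = y + sum x {k + 2..n}"
      using k by (simp add: y_def sum.atLeast_Suc_atMost[of "Suc k"] One_nat_def)
    have A: "x 1 + sum x {k + 2..n} \<le> y"
      and B: "(real k - 1) * (x 1 + sum x {k + 3..n}) \<le> y"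
      and C: "(real n - 2) * fact (n - 2) * x 1 \<le> real k * fact (k - 2) * y"
      using IH by (simp_all add: y_def numeral_3_eq_3 numeral_2_eq_2 One_nat_def)
    have "0 \<le> real k * fact (k - 2) * y"
      using n nonneg by (intro order_trans[OF _ C] mult_nonneg_nonneg) simp_all
    then have y: "y \<ge> 0"
      using k mult_le_cancel_left_pos[of "real k * fact (k - 2)" 0 y] by simp
    \<comment> \<open>Solving the recurrence for \<open>x k\<close> subtracts, hence the real
      values. By \<open>B\<close> the subtracted term is at most \<open>y / (k - 1)\<close>.\<close>
    have xk: "x k = (real k - 1) * y - (x 1 + sum x {k + 3..n})"
      using rec[of k] k by (simp add: y_def)
    have "(real k - 1) * x k = (real k - 1)\<^sup>2 * y - (real k - 1) * (x 1 + sum x {k + 3..n})"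
      by (simp add: xk power2_eq_square algebra_simps)
    also have "\<dots> \<ge> (real k - 1)\<^sup>2 * y - y"
      using B by simp
    finally have growth: "(real k - 1) * x k \<ge> real k * (real k - 2) * y"
      by (simp add: power2_eq_square algebra_simps)
    have lower: "x k \<ge> a * y" if "(real k - 1) * a \<le> real k * (real k - 2)" for a
    proof -
      have "(real k - 1) * (a * y) \<le> (real k - 1) * x k"
        using mult_right_mono[OF that y] growth by (simp add: mult.assoc)
      then show ?thesis
        using k by simp
    qed
    \<comment> \<open>With \<open>A\<close> this yields the first conjunct. The inequality on
      \<open>k\<close> behind it fails at \<open>k = 3\<close>, so the descent stops at 4.\<close>
    have "2 * y \<le> x k"
    proof (rule lower)
      have "4 * real k \<le> real k * real k"
        using k by (intro mult_right_mono) simp_all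
      then show "(real k - 1) * 2 \<le> real k * (real k - 2)"
        by (simp add: algebra_simps)
    qed
    moreover have "(real k - 2) * y \<le> x k"
      using k by (intro lower) (simp add: algebra_simps)
    moreover have "(real k - 2) * (x 1 + sum x {k + 2..n}) \<le> (real k - 2) * y"
      using A k by (intro mult_left_mono) simp_all
    moreover have "real k * fact (k - 2) * y \<le> (real k - 1) * fact (k - 3) * x k"
    proof -
      have "k - 2 = Suc (k - 3)"
        using k by simp
      then have "fact (k - 2) = (real k - 2) * fact (k - 3)"
        using k by (simp add: of_nat_diff)
      then have "real k * fact (k - 2) * y = fact (k - 3) * (real k * (real k - 2) * y)"
        by simp
      also have "\<dots> \<le> fact (k - 3) * ((real k - 1) * x k)"
        using growth by (intro mult_left_mono) simp_all
      finally show ?thesis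
        by (simp add: mult_ac)
    qed
    ultimately show "?P k"
      using split A C by simp
  qed
  then have "(real n - 2) * fact (n - 2) * x 1 \<le> 3 * x 4"
    by simp
  \<comment> \<open>The constant 6 is the factor \<open>k - 1 = 3\<close> at \<open>k = 4\<close>
    times the 2 lost here.\<close>
  moreover have "fact (n - 1) / 2 * x 1 \<le> (real n - 2) * fact (n - 2) * x 1"
  proof -
    have "n - 1 = Suc (n - 2)"
      using n by simp
    then have "fact (n - 1) = (real n - 1) * fact (n - 2)"
      using n by (simp add: of_nat_diff)
    moreover have "(real n - 1) / 2 * (fact (n - 2) * x 1) \<le> (real n - 2) * (fact (n - 2) * x 1)"
      using n nonneg by (intro mult_right_mono) simp_all
    ultimately show ?thesis
      by (simp add: mult.assoc)
  qed
  ultimately show ?thesis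
    by simp
qed

section \<open>From firing counts to the convergent period\<close>

lemma game_period_useful_orientation_ge:
  assumes n: "n \<ge> 6" and chips: "total_chips (useful_orientation n) s \<ge> n * (n - 3) div 2 + 1"
  shows "fact (n - 1) / 6 \<le> real (game_period (useful_orientation n) s)"
proof -
  let ?D = "useful_orientation n"
  interpret pair_digraph ?D
    using n by (intro pair_digraph_useful_orientation) simp
  have n4: "n \<ge> 4"
    using n by simp
  have lt: "sum (out_degree ?D) (pverts ?D) < total_chips ?D s + card (pverts ?D)"
    using chips sum_out_degree_useful_orientation[OF n4] by (simp add: pverts_useful_orientation)
  obtain x :: "nat \<Rightarrow> nat" where le: "\<And>v. x v \<le> game_period ?D s"
    and bal: "\<And>v. v \<in> {1..n} \<Longrightarrow>
       out_degree ?D v * x v = sum x {u \<in> {1..n}. (u, v) \<in> parcs ?D}"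
    and ex: "\<exists>v\<in>{1..n}. x v > 0"
    using firing_counts[OF lt, unfolded pverts_useful_orientation] by blast
  have xn: "x n = (n - 2) * x 1"
    using bal[of 1] n out_degree_useful_orientation(1)[OF n4]
      in_neighbours_useful_orientation(1)[OF n4] by simp
  have xn1: "x (n - 1) = (n - 2) * x n"
    using bal[of n] n out_degree_useful_orientation(3)[OF n4, of n]
      in_neighbours_useful_orientation(2)[OF n4] by simp
  have rec: "(k - 1) * x (Suc k) = x 1 + x k + sum x {k + 3..n}" if "2 \<le> k" "Suc k < n" for k
    using bal[of "Suc k"] that out_degree_useful_orientation(3)[OF n4, of "Suc k"]
      in_neighbours_useful_orientation(3)[OF n4, of "Suc k"] by (simp add: numeral_3_eq_3)
  \<comment> \<open>If \<open>x 1\<close> vanished, so would \<open>x n\<close> and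
    \<open>x (n - 1)\<close>. Going down, \<open>x j\<close> is then a summand of a sum of naturals
    equal to 0, so no vertex would ever fire during the period.\<close>
  have "x 1 \<noteq> 0"
  proof
    assume x1: "x 1 = 0"
    have "x k = 0" if "2 \<le> k" "k \<le> n - 1" for k
      using that(2)
    proof (induction rule: inc_induct)
      case base
      then show ?case
        by (simp only: xn1 xn x1 mult_0_right)
    next
      case (step j)
      then show ?case
        using rec[of j] that by simp
    qed
    then have "x v = 0" if "v \<in> {1..n}" for v
      using that x1 xn by (cases "v = 1"; cases "v = n") auto
    then show False
      using ex by auto
  qed
  then have x1: "real (x 1) \<ge> 1"
    by linarith
  have "real (x 4) \<ge> fact (n - 1) / 6 * real (x 1)"
  proof (rule harmonic_lower_bound[OF n])
    show "real (x n) = (real n - 2) * real (x 1)" "real (x (n - 1)) = (real n - 2) * real (x n)"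
      using n by (simp_all only: xn xn1 of_nat_mult) (simp_all add: of_nat_diff)
    show "(real k - 1) * real (x (Suc k)) = real (x 1) + real (x k) + (\<Sum>i = k + 3..n. real (x i))"
      if "4 \<le> k" "Suc k < n" for k
      using arg_cong[OF rec[of k], of real] that by (simp add: of_nat_diff)
  qed (use x1 in simp)
  moreover have "fact (n - 1) / 6 * real (x 1) \<ge> fact (n - 1) / 6"
    using mult_left_mono[OF x1, of "fact (n - 1) / 6"] by simp
  ultimately show ?thesis
    using le[of 4] by linarith
qed

lemma convergent_period_attained:
  assumes "finite (pverts D)" "pverts D \<noteq> {}"
  obtains s where "total_chips D s \<ge> c" and "game_period D s = convergent_period c D"
proof -
  \<comment> \<open>Some game must qualify before the minimum is attained; \<open>c\<close> chips on
    every vertex suffice, as there is at least one vertex.\<close>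
  have "total_chips D (\<lambda>_. c) \<ge> c"
    using assms by (simp add: total_chips_def Suc_leI card_gt_0_iff)
  then have "\<exists>T s. total_chips D s \<ge> c \<and> game_period D s = T"
    by blast
  from LeastI_ex[OF this] show thesis
    using that unfolding convergent_period_def by blast
qed

theorem theorem3p10:
  shows "(\<lambda>n. real (convergent_period (n * (n - 3) div 2 + 1) (useful_orientation n)))
           \<in> \<Omega>(\<lambda>n. fact (n - 1))"
proof (rule landau_omega.bigI[of "1 / 6"])
  have "fact (n - 1) / 6 \<le> real (convergent_period (n * (n - 3) div 2 + 1) (useful_orientation n))"
    if "n \<ge> 6" for n
  proof -
    have "finite (pverts (useful_orientation n))" "pverts (useful_orientation n) \<noteq> {}"
      using that by (simp_all add: pverts_useful_orientation)
    then obtain s where "total_chips (useful_orientation n) s \<ge> n * (n - 3) div 2 + 1"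
      and "game_period (useful_orientation n) s =
        convergent_period (n * (n - 3) div 2 + 1) (useful_orientation n)"
      by (rule convergent_period_attained)
    then show ?thesis
      using game_period_useful_orientation_ge[OF that] by metis
  qed
  then show "\<forall>\<^sub>F n in at_top.
      norm (real (convergent_period (n * (n - 3) div 2 + 1) (useful_orientation n)))
        \<ge> 1 / 6 * norm (fact (n - 1) :: real)"
    by (intro eventually_at_top_linorderI[of 6]) simp
qed simp

end
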